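(* Let $(X,d)$ be a metric space. The following are equivalent. (a) $(X,d)$ is complete. (b) For every metric space $(Y,\rho)$, each continuous function from $(X,d)$ to $(Y,\rho)$ is TB-regular. (c) For every metric space $(Y,\rho)$, each locally Lipschitz function from $(X,d)$ to $(Y,\rho)$ is TB-regular. (d) Each real-valued locally Lipschitz function on $(X,d)$ is TB-regular.
   Context: A subset $A$ of a metric space $(X,d)$ is totally bounded if for every $\epsilon>0$ there is a finite set $\{x_1,\dots,x_n\}\subseteq X$ with $A\subseteq\bigcup_{i=1}^n B(x_i,\epsilon)$, where $B(x,\epsilon)$ is the open ball. A (not necessarily continuous) function $f:(X,d)\to(Y,\rho)$ between metric spaces is TB-regular if $f(A)$ is totally bounded for every totally bounded subset $A$ of $X$. The function $f$ is locally Lipschitz if for each $x\in X$ there exists $\delta_x>0$ such that $f$ restricted to $B(x,\delta_x)$ is Lipschitz. $\mathbb{R}$ carries its usual metric. *)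

theory Defs
  imports "HOL-Analysis.Abstract_Metric_Spaces"
begin

text \<open>A metric space is a value of the library type \<open>'a metric\<close>: a carrier \<open>mspace X\<close> together with
  a distance \<open>mdist X\<close>. Functions are total on the type, but only their values on the carrier
  matter.\<close>

definition mtotally_bounded_of :: "'a metric \<Rightarrow> 'a set \<Rightarrow> bool" where
  "mtotally_bounded_of X \<equiv> Metric_space.mtotally_bounded (mspace X) (mdist X)"

text \<open>The library takes the centres of the balls in \<open>A\<close>; taking them in the whole space gives the
  same notion.\<close>

lemma mtotally_bounded_of_iff:
  "mtotally_bounded_of X A \<longleftrightarrow>
     A \<subseteq> mspace X \<and>
     (\<forall>\<epsilon>>0. \<exists>K. finite K \<and> K \<subseteq> mspace X \<and> A \<subseteq> (\<Union>x\<in>K. mball_of X x \<epsilon>))"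
    (is "?L \<longleftrightarrow> _ \<and> ?R")
proof -
  interpret Metric_space "mspace X" "mdist X" by simp
  show ?thesis
  proof
    assume L: ?L
    then show "A \<subseteq> mspace X \<and> ?R"
      unfolding mtotally_bounded_of_def mball_of_def
      using mtotally_bounded_imp_subset[of A] mtotally_bounded_def[of A] by (meson order_trans)
  next
    assume R: "A \<subseteq> mspace X \<and> ?R"
    show ?L
      unfolding mtotally_bounded_of_def mtotally_bounded_def
    proof (intro allI impI)
      fix \<epsilon> :: real assume "\<epsilon> > 0"
      then obtain K where K: "finite K" "A \<subseteq> (\<Union>x\<in>K. mball x (\<epsilon>/2))"
        using R unfolding mball_of_def by (meson half_gt_zero)
      define J where "J = {x \<in> K. mball x (\<epsilon>/2) \<inter> A \<noteq> {}}"
      then have "\<forall>x\<in>J. \<exists>a. a \<in> mball x (\<epsilon>/2) \<inter> A" by blast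
      then obtain c where c: "\<And>x. x \<in> J \<Longrightarrow> c x \<in> mball x (\<epsilon>/2) \<inter> A" by metis
      have "A \<subseteq> (\<Union>y \<in> c ` J. mball y \<epsilon>)"
      proof
        fix a assume a: "a \<in> A"
        then obtain x where x: "x \<in> K" "a \<in> mball x (\<epsilon>/2)" using K by blast
        then have "x \<in> J" using a J_def by blast
        with c[OF this] x(2) have "a \<in> mball (c x) \<epsilon>"
          using triangle[of "c x" x a] commute[of x "c x"] by auto
        with \<open>x \<in> J\<close> show "a \<in> (\<Union>y \<in> c ` J. mball y \<epsilon>)" by blast
      qed
      moreover have "finite (c ` J)" "c ` J \<subseteq> A" using K c by (auto simp: J_def)
      ultimately show "\<exists>K. finite K \<and> K \<subseteq> A \<and> A \<subseteq> (\<Union>x\<in>K. mball x \<epsilon>)" by blast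
    qed
  qed
qed

definition TB_regular :: "'a metric \<Rightarrow> 'b metric \<Rightarrow> ('a \<Rightarrow> 'b) \<Rightarrow> bool" where
  "TB_regular X Y f \<longleftrightarrow>
     f \<in> mspace X \<rightarrow> mspace Y \<and>
     (\<forall>A. mtotally_bounded_of X A \<longrightarrow> mtotally_bounded_of Y (f ` A))"

definition locally_Lipschitz_map :: "'a metric \<Rightarrow> 'b metric \<Rightarrow> ('a \<Rightarrow> 'b) \<Rightarrow> bool" where
  "locally_Lipschitz_map X Y f \<longleftrightarrow>
     f \<in> mspace X \<rightarrow> mspace Y \<and>
     (\<forall>x \<in> mspace X. \<exists>\<delta>>0. Lipschitz_continuous_map (submetric X (mball_of X x \<delta>)) Y f)"

text \<open>A HOL formula cannot quantify over all types, so ``for every metric space \<open>Y\<close>'' has to be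
  rendered as a quantifier over \<open>Y :: 'u metric\<close> for some type \<open>'u\<close> of points. The type used is
  \<open>'b + real\<close> with \<open>'b\<close> an arbitrary type variable: it contains a copy of every metric space on
  \<open>'b\<close> and a copy of the real line. The lemmas below justify this: both properties carry over from
  all metric spaces on \<open>'u\<close> to all metric spaces on any type that injects into \<open>'u\<close>.\<close>

definition copy_metric :: "('c \<Rightarrow> 'u) \<Rightarrow> 'c metric \<Rightarrow> 'u metric" where
  "copy_metric e Y = metric (e ` mspace Y, \<lambda>u v. mdist Y (inv e u) (inv e v))"

lemma
  assumes "inj e"
  shows mspace_copy_metric: "mspace (copy_metric e Y) = e ` mspace Y"
    and mdist_copy_metric: "mdist (copy_metric e Y) u v = mdist Y (inv e u) (inv e v)"
proof -
  interpret Y: Metric_space "mspace Y" "mdist Y" by simp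
  interpret C: Metric_space "e ` mspace Y" "\<lambda>u v. mdist Y (inv e u) (inv e v)"
    by standard (auto simp: assms Y.commute Y.triangle)
  show "mspace (copy_metric e Y) = e ` mspace Y"
    by (simp add: copy_metric_def C.mspace_metric)
  show "mdist (copy_metric e Y) u v = mdist Y (inv e u) (inv e v)"
    by (simp add: copy_metric_def C.mdist_metric)
qed

lemma continuous_map_copy_metric:
  assumes e: "inj e" and f: "continuous_map (mtopology_of X) (mtopology_of Y) f"
  shows "continuous_map (mtopology_of X) (mtopology_of (copy_metric e Y)) (e \<circ> f)"
proof -
  have "Lipschitz_continuous_map Y (copy_metric e Y) e"
    unfolding Lipschitz_continuous_map_def
    by (auto simp: mspace_copy_metric mdist_copy_metric e intro!: exI[of _ 1])
  then have "continuous_map (mtopology_of Y) (mtopology_of (copy_metric e Y)) e"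
    using Lipschitz_imp_uniformly_continuous_map uniformly_continuous_imp_continuous_map by blast
  with f show ?thesis by (rule continuous_map_compose)
qed

lemma locally_Lipschitz_map_copy_metric:
  assumes "inj e"
  shows "locally_Lipschitz_map X (copy_metric e Y) (e \<circ> f) \<longleftrightarrow> locally_Lipschitz_map X Y f"
  using assms unfolding locally_Lipschitz_map_def Lipschitz_continuous_map_def
  by (simp add: mspace_copy_metric mdist_copy_metric Pi_iff inj_image_mem_iff)

lemma TB_regular_copy_metric:
  assumes "inj e" and "TB_regular X (copy_metric e Y) (e \<circ> f)"
  shows "TB_regular X Y f"
proof -
  have "mtotally_bounded_of Y B" if B: "mtotally_bounded_of (copy_metric e Y) (e ` B)" for B
  proof -
    have sub: "B \<subseteq> mspace Y"
      using B assms(1) by (auto simp: mtotally_bounded_of_iff mspace_copy_metric inj_image_subset_iff)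
    have "Lipschitz_continuous_map (copy_metric e Y) Y (inv e)"
      unfolding Lipschitz_continuous_map_def
      by (auto simp: mspace_copy_metric mdist_copy_metric assms(1) intro!: exI[of _ 1])
    then have "Cauchy_continuous_map (copy_metric e Y) Y (inv e)"
      by (rule Lipschitz_imp_Cauchy_continuous_map)
    from mtotally_bounded_Cauchy_continuous_image[OF this B[unfolded mtotally_bounded_of_def]]
    show ?thesis
      by (simp add: mtotally_bounded_of_def image_image assms(1))
  qed
  then have "mtotally_bounded_of Y (f ` A)" if "mtotally_bounded_of X A" for A
    using assms(2) that by (simp add: TB_regular_def image_image)
  moreover have "f \<in> mspace X \<rightarrow> mspace Y"
    using assms by (auto simp: TB_regular_def mspace_copy_metric Pi_iff inj_image_mem_iff)
  ultimately show ?thesis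
    by (simp add: TB_regular_def)
qed

lemma continuous_TB_regular_transfer:
  fixes X :: "'a metric" and e :: "'c \<Rightarrow> 'u" and Y :: "'c metric"
  assumes "inj e"
    and "\<forall>(Y :: 'u metric) f. continuous_map (mtopology_of X) (mtopology_of Y) f \<longrightarrow> TB_regular X Y f"
    and "continuous_map (mtopology_of X) (mtopology_of Y) f"
  shows "TB_regular X Y f"
  using assms continuous_map_copy_metric TB_regular_copy_metric by metis

lemma locally_Lipschitz_TB_regular_transfer:
  fixes X :: "'a metric" and e :: "'c \<Rightarrow> 'u" and Y :: "'c metric"
  assumes "inj e"
    and "\<forall>(Y :: 'u metric) f. locally_Lipschitz_map X Y f \<longrightarrow> TB_regular X Y f"
    and "locally_Lipschitz_map X Y f"
  shows "TB_regular X Y f"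
  using assms locally_Lipschitz_map_copy_metric TB_regular_copy_metric by metis

end

theory Submission
  imports Defs
begin

text \<open>
  In a complete space the closure of a totally bounded set is compact, and a continuous map sends
  it to a compact, hence totally bounded, set. Locally Lipschitz maps are continuous, and the real
  line embeds isometrically into one of the admissible target spaces, so the three mapping
  properties become successively weaker.

  It remains to show that the weakest one forces completeness. If a Cauchy sequence \<open>\<sigma>\<close> has no limit
  in \<open>X\<close>, it still has one, \<open>p\<close>, in the completion, and the distance to \<open>p\<close> can be written without
  the completion as \<open>g x = lim (\<lambda>n. d x (\<sigma> n))\<close>. This \<open>g\<close> is \<open>1\<close>-Lipschitz and vanishes nowhere on
  \<open>X\<close>, so \<open>1 / g\<close> is locally Lipschitz. Along \<open>\<sigma>\<close> the values of \<open>g\<close> tend to \<open>0\<close>; hence \<open>1 / g\<close> is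
  unbounded on \<open>range \<sigma>\<close>, although the range of a Cauchy sequence is totally bounded.
\<close>

text \<open>On each of the open balls the restriction is Lipschitz, hence continuous, and these balls
  cover the space, so the restrictions paste together.\<close>

lemma locally_Lipschitz_imp_continuous_map:
  assumes "locally_Lipschitz_map X Y f"
  shows "continuous_map (mtopology_of X) (mtopology_of Y) f"
proof -
  interpret Metric_space "mspace X" "mdist X" by simp
  obtain \<delta> where pos: "\<And>x. x \<in> mspace X \<Longrightarrow> \<delta> x > 0"
    and Lip: "\<And>x. x \<in> mspace X \<Longrightarrow>
                Lipschitz_continuous_map (submetric X (mball_of X x (\<delta> x))) Y f"
    using assms unfolding locally_Lipschitz_map_def by metis
  show ?thesis
  proof (rule pasting_lemma[where I = "mspace X" and T = "\<lambda>x. mball_of X x (\<delta> x)" and f = "\<lambda>_. f"])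
    show "openin (mtopology_of X) (mball_of X x (\<delta> x))" for x
      by (simp add: mtopology_of_def mball_of_def)
    show "continuous_map (subtopology (mtopology_of X) (mball_of X x (\<delta> x))) (mtopology_of Y) f"
      if "x \<in> mspace X" for x
      using Lipschitz_continuous_imp_continuous_map[OF Lip[OF that]]
      by (simp add: mtopology_of_submetric)
    show "\<exists>j. j \<in> mspace X \<and> x \<in> mball_of X j (\<delta> j) \<and> f x = f x"
      if "x \<in> topspace (mtopology_of X)" for x
      using that pos[of x] by (intro exI[of _ x]) auto
  qed auto
qed

text \<open>Continuity alone preserves neither Cauchy sequences nor total boundedness; completeness lets
  the argument pass through compactness, which continuous maps do preserve.\<close>

lemma complete_continuous_imp_TB_regular:
  assumes "mcomplete_of X" and f: "continuous_map (mtopology_of X) (mtopology_of Y) f"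
  shows "TB_regular X Y f"
  unfolding TB_regular_def
proof (intro conjI allI impI)
  interpret X: Metric_space "mspace X" "mdist X" by simp
  interpret Y: Metric_space "mspace Y" "mdist Y" by simp
  show "f \<in> mspace X \<rightarrow> mspace Y"
    using continuous_map_funspace[OF f] by simp
  fix A
  assume "mtotally_bounded_of X A"
  then have A: "A \<subseteq> mspace X" and "compactin X.mtopology (X.mtopology closure_of A)"
    using assms(1) X.mtotally_bounded_eq_compact_closure_of
    by (auto simp: mtotally_bounded_of_def mcomplete_of_def)
  then have "Y.mtotally_bounded (f ` (X.mtopology closure_of A))"
    using f by (intro Y.compactin_imp_mtotally_bounded image_compactin) (auto simp: mtopology_of_def)
  moreover have "f ` A \<subseteq> f ` (X.mtopology closure_of A)"
    using A by (intro image_mono closure_of_subset) simp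
  ultimately show "mtotally_bounded_of Y (f ` A)"
    unfolding mtotally_bounded_of_def by (rule Y.mtotally_bounded_subset)
qed

context Metric_space
begin

text \<open>The distance to the limit of \<open>\<sigma>\<close> in the completion. It is written as a limit of distances
  inside the space, so that it makes sense for a Cauchy sequence without a limit in the space.\<close>

definition dist_to_lim :: "(nat \<Rightarrow> 'a) \<Rightarrow> 'a \<Rightarrow> real" where
  "dist_to_lim \<sigma> x = lim (\<lambda>n. d x (\<sigma> n))"

lemma dist_to_lim_LIMSEQ:
  assumes \<sigma>: "MCauchy \<sigma>" and x: "x \<in> M"
  shows "(\<lambda>n. d x (\<sigma> n)) \<longlonglongrightarrow> dist_to_lim \<sigma> x"
proof -
  have in_M: "\<sigma> n \<in> M" for n
    using \<sigma> by (auto simp: MCauchy_def)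
  have "Cauchy (\<lambda>n. d x (\<sigma> n))"
  proof (rule metric_CauchyI)
    fix e :: real assume "e > 0"
    with \<sigma> obtain N where N: "\<And>m n. N \<le> m \<Longrightarrow> N \<le> n \<Longrightarrow> d (\<sigma> m) (\<sigma> n) < e"
      unfolding MCauchy_def by metis
    have "dist (d x (\<sigma> m)) (d x (\<sigma> n)) < e" if "m \<ge> N" "n \<ge> N" for m n
      using mdist_reverse_triangle[of "\<sigma> m" x "\<sigma> n"] in_M x N[OF that]
      by (simp add: dist_real_def commute)
    then show "\<exists>N. \<forall>m\<ge>N. \<forall>n\<ge>N. dist (d x (\<sigma> m)) (d x (\<sigma> n)) < e" by blast
  qed
  then show ?thesis
    unfolding dist_to_lim_def by (simp add: Cauchy_convergent_iff convergent_LIMSEQ_iff)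
qed

lemma dist_to_lim_1_Lipschitz:
  assumes \<sigma>: "MCauchy \<sigma>" and "x \<in> M" "y \<in> M"
  shows "\<bar>dist_to_lim \<sigma> x - dist_to_lim \<sigma> y\<bar> \<le> d x y"
proof (rule LIMSEQ_le_const2)
  show "(\<lambda>n. \<bar>d x (\<sigma> n) - d y (\<sigma> n)\<bar>) \<longlonglongrightarrow> \<bar>dist_to_lim \<sigma> x - dist_to_lim \<sigma> y\<bar>"
    using assms by (intro tendsto_intros dist_to_lim_LIMSEQ)
  show "\<exists>N. \<forall>n\<ge>N. \<bar>d x (\<sigma> n) - d y (\<sigma> n)\<bar> \<le> d x y"
  proof (intro exI allI impI)
    show "\<bar>d x (\<sigma> n) - d y (\<sigma> n)\<bar> \<le> d x y" for n
      using assms mdist_reverse_triangle[of x "\<sigma> n" y] commute[of y "\<sigma> n"]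
      by (auto simp: MCauchy_def)
  qed
qed

text \<open>A point at distance \<open>0\<close> from the ideal limit would be an actual limit.\<close>

lemma dist_to_lim_pos:
  assumes \<sigma>: "MCauchy \<sigma>" and no_lim: "\<nexists>l. limitin mtopology \<sigma> l sequentially" and x: "x \<in> M"
  shows "dist_to_lim \<sigma> x > 0"
proof -
  have lim: "(\<lambda>n. d x (\<sigma> n)) \<longlonglongrightarrow> dist_to_lim \<sigma> x"
    using \<sigma> x by (rule dist_to_lim_LIMSEQ)
  then have "dist_to_lim \<sigma> x \<ge> 0"
    by (rule LIMSEQ_le_const) simp
  moreover have "dist_to_lim \<sigma> x \<noteq> 0"
  proof
    assume "dist_to_lim \<sigma> x = 0"
    with lim have "(\<lambda>n. d (\<sigma> n) x) \<longlonglongrightarrow> 0"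
      by (simp add: commute)
    then have "limitin mtopology \<sigma> x sequentially"
      using \<sigma> x by (auto simp: limitin_metric_dist_null MCauchy_def intro!: always_eventually)
    with no_lim show False by blast
  qed
  ultimately show ?thesis by simp
qed

text \<open>The terms of a Cauchy sequence come arbitrarily close to all later ones, and hence to the
  ideal limit. This makes the reciprocal of the distance unbounded along the sequence.\<close>

lemma dist_to_lim_small_on_sequence:
  assumes \<sigma>: "MCauchy \<sigma>" and "e > 0"
  shows "\<exists>n. dist_to_lim \<sigma> (\<sigma> n) \<le> e"
proof -
  obtain N where N: "\<And>m n. m \<ge> N \<Longrightarrow> n \<ge> N \<Longrightarrow> d (\<sigma> m) (\<sigma> n) < e"
    using assms unfolding MCauchy_def by metis
  have "\<sigma> N \<in> M"
    using \<sigma> by (auto simp: MCauchy_def)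
  with \<sigma> have "(\<lambda>n. d (\<sigma> N) (\<sigma> n)) \<longlonglongrightarrow> dist_to_lim \<sigma> (\<sigma> N)"
    by (rule dist_to_lim_LIMSEQ)
  then have "dist_to_lim \<sigma> (\<sigma> N) \<le> e"
    by (rule LIMSEQ_le_const2) (use N in \<open>auto intro!: exI[of _ N] less_imp_le\<close>)
  then show ?thesis ..
qed

end

text \<open>Near \<open>x\<close> the function stays away from \<open>0\<close>: on the ball of radius \<open>g x / 2\<close> it is at
  least \<open>g x / 2\<close>, and inversion is Lipschitz on \<open>[g x / 2, \<infinity>)\<close>.\<close>

lemma locally_Lipschitz_map_inverse:
  fixes g :: "'a \<Rightarrow> real"
  assumes pos: "\<And>x. x \<in> mspace X \<Longrightarrow> g x > 0"
    and Lip: "\<And>x y. x \<in> mspace X \<Longrightarrow> y \<in> mspace X \<Longrightarrow> \<bar>g x - g y\<bar> \<le> mdist X x y"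
  shows "locally_Lipschitz_map X euclidean_metric (\<lambda>x. inverse (g x))"
  unfolding locally_Lipschitz_map_def
proof (intro conjI ballI)
  fix x assume x: "x \<in> mspace X"
  define c where "c = g x / 2"
  have c: "c > 0"
    using pos[OF x] by (simp add: c_def)
  have far: "g y \<ge> c" if "y \<in> mspace X" "mdist X x y < c" for y
    using Lip[OF x that(1)] that(2) by (simp add: c_def abs_le_iff)
  have "dist (inverse (g y)) (inverse (g z)) \<le> inverse (c * c) * mdist X y z"
    if yz: "y \<in> mspace X" "mdist X x y < c" "z \<in> mspace X" "mdist X x z < c" for y z
  proof -
    have gy: "g y \<ge> c" and gz: "g z \<ge> c"
      using far yz by auto
    have "inverse (g y) - inverse (g z) = (g z - g y) * inverse (g y * g z)"
      using gy gz c by (simp add: field_simps)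
    then have "dist (inverse (g y)) (inverse (g z)) = \<bar>g z - g y\<bar> * inverse (g y * g z)"
      using gy gz c by (simp add: dist_real_def abs_mult)
    also have "\<dots> \<le> mdist X y z * inverse (c * c)"
      using Lip[OF yz(1,3)] gy gz c
      by (intro mult_mono le_imp_inverse_le) (auto simp: abs_minus_commute)
    finally show ?thesis by (simp add: mult.commute)
  qed
  then have "Lipschitz_continuous_map (submetric X (mball_of X x c)) euclidean_metric
               (\<lambda>x. inverse (g x))"
    unfolding Lipschitz_continuous_map_def by (auto intro!: exI[of _ "inverse (c * c)"])
  with c show "\<exists>\<delta>>0. Lipschitz_continuous_map (submetric X (mball_of X x \<delta>)) euclidean_metric
               (\<lambda>x. inverse (g x))"
    by blast
qed simp

text \<open>For a Cauchy sequence \<open>\<sigma>\<close> without limit, the reciprocal of \<open>dist_to_lim \<sigma>\<close> is locally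
  Lipschitz, but it maps the totally bounded set \<open>range \<sigma>\<close> to an unbounded set.\<close>

lemma real_locally_Lipschitz_TB_regular_imp_complete:
  assumes reg: "\<And>f :: 'a \<Rightarrow> real. locally_Lipschitz_map X euclidean_metric f \<Longrightarrow>
                  TB_regular X euclidean_metric f"
  shows "mcomplete_of X"
proof (rule ccontr)
  interpret Metric_space "mspace X" "mdist X" by simp
  assume "\<not> mcomplete_of X"
  then obtain \<sigma> where \<sigma>: "MCauchy \<sigma>" and no_lim: "\<nexists>l. limitin mtopology \<sigma> l sequentially"
    by (auto simp: mcomplete_of_def mcomplete_def)
  define g where "g = dist_to_lim \<sigma>"
  have g_pos: "g x > 0" if "x \<in> mspace X" for x
    using dist_to_lim_pos[OF \<sigma> no_lim that] by (simp add: g_def)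
  have "locally_Lipschitz_map X euclidean_metric (\<lambda>x. inverse (g x))"
    using g_pos dist_to_lim_1_Lipschitz[OF \<sigma>]
    by (intro locally_Lipschitz_map_inverse) (auto simp: g_def)
  then have "TB_regular X euclidean_metric (\<lambda>x. inverse (g x))"
    by (rule reg)
  moreover have "mtotally_bounded_of X (range \<sigma>)"
    using mtotally_bounded_cauchy_sequence[OF \<sigma>] by (simp add: mtotally_bounded_of_def)
  ultimately have "mtotally_bounded_of euclidean_metric ((\<lambda>x. inverse (g x)) ` range \<sigma>)"
    by (simp add: TB_regular_def)
  then have "bounded ((\<lambda>x. inverse (g x)) ` range \<sigma>)"
    using Met_TC.mtotally_bounded_imp_mbounded by (simp add: mtotally_bounded_of_def)
  then obtain B where B: "B > 0" "\<And>n. \<bar>inverse (g (\<sigma> n))\<bar> \<le> B"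
    unfolding bounded_pos by auto
  \<comment> \<open>The factor \<open>2\<close> turns the weak bound on \<open>g (\<sigma> n)\<close> into a strict contradiction with \<open>B\<close>.\<close>
  obtain n where n: "g (\<sigma> n) \<le> inverse (2 * B)"
    using dist_to_lim_small_on_sequence[OF \<sigma>, of "inverse (2 * B)"] B(1) by (auto simp: g_def)
  have "g (\<sigma> n) > 0"
    using g_pos \<sigma> by (auto simp: MCauchy_def)
  with n have "2 * B \<le> inverse (g (\<sigma> n))"
    using le_imp_inverse_le[OF n] by (simp del: inverse_mult_distrib)
  with abs_le_D1[OF B(2), of n] B(1) show False by linarith
qed

theorem theorem2:
  fixes X :: "'a metric"
  shows
    "(mcomplete_of X \<longleftrightarrow>
        (\<forall>(Y :: ('b + real) metric) f.
           continuous_map (mtopology_of X) (mtopology_of Y) f \<longrightarrow> TB_regular X Y f)) \<and>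
     (mcomplete_of X \<longleftrightarrow>
        (\<forall>(Y :: ('b + real) metric) f.
           locally_Lipschitz_map X Y f \<longrightarrow> TB_regular X Y f)) \<and>
     (mcomplete_of X \<longleftrightarrow>
        (\<forall>f :: 'a \<Rightarrow> real.
           locally_Lipschitz_map X euclidean_metric f \<longrightarrow> TB_regular X euclidean_metric f))"
    (is "(?a \<longleftrightarrow> ?b) \<and> (?a \<longleftrightarrow> ?c) \<and> (?a \<longleftrightarrow> ?d)")
proof -
  have ab: ?b if ?a
    using that complete_continuous_imp_TB_regular by blast
  have bc: ?c if ?b
    using that locally_Lipschitz_imp_continuous_map by blast
  have cd: ?d if c: ?c
  proof (intro allI impI)
    fix f :: "'a \<Rightarrow> real"
    assume f: "locally_Lipschitz_map X euclidean_metric f"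
    \<comment> \<open>A real-valued map counts as one into the copy of the real line inside \<open>'b + real\<close>.\<close>
    have "inj (Inr :: real \<Rightarrow> 'b + real)" by simp
    from locally_Lipschitz_TB_regular_transfer[OF this c f]
    show "TB_regular X euclidean_metric f" .
  qed
  have da: ?a if ?d
    using that real_locally_Lipschitz_TB_regular_imp_complete by blast
  from ab bc cd da show ?thesis by argo
qed

end
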